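(* Let $p$, $p_1$ and $p_2$ be positive numbers such that $p<1<p_2$ and $\frac1p=\frac1{p_1}+\frac1{p_2}$. If $f$ is an analytic function in $\mathbb{D}$ such that $f=f_1\cdot f_2$, where $f_1\in\mathcal{D}^{p_1}_{p_1-1}$ and $f_2$ is an analytic function in $\mathbb{D}$ satisfying $|f_2(z)|=\mathrm{O}\left(\frac{1}{(1-|z|)^{1/p_2}}\right)$ as $|z|\to1^-$, then $f$ is the derivative of a function in $H^{\frac{p}{1-p}}$.
   Context: $\mathbb{D}=\{z\in\mathbb{C}:|z|<1\}$, and $dA(z)=\frac{dx\,dy}{\pi}$. For $0<s<\infty$, the Hardy space $H^s$ consists of analytic functions $f$ in $\mathbb{D}$ with $\|f\|_{H^s}=\lim_{r\to1^-}\left(\frac{1}{2\pi}\int_0^{2\pi}|f(re^{i\theta})|^s\,d\theta\right)^{1/s}<\infty$. The Dirichlet-type space $\mathcal{D}^s_{s-1}$ consists of analytic functions $f$ in $\mathbb{D}$ with $\|f\|_{\mathcal{D}^s_{s-1}}^s=\int_{\mathbb{D}}|f'(z)|^s(1-|z|^2)^{s-1}\,dA(z)+|f(0)|^s<\infty$. *)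

theory Defs
  imports "HOL-Analysis.Analysis" "HOL-Library.Landau_Symbols"
begin

definition integral_mean :: "real \<Rightarrow> (complex \<Rightarrow> complex) \<Rightarrow> real \<Rightarrow> real" where
  "integral_mean s f r =
     (1 / (2 * pi) * integral {0..2 * pi} (\<lambda>\<theta>. cmod (f (of_real r * cis \<theta>)) powr s)) powr (1 / s)"

text \<open>Finiteness of the \<open>H\<^sup>s\<close> norm: the means converge to a real number as \<open>r \<rightarrow> 1\<^sup>-\<close>.\<close>

definition hardy_space :: "real \<Rightarrow> (complex \<Rightarrow> complex) set" where
  "hardy_space s =
     {f. f holomorphic_on ball 0 1 \<and> (\<exists>L::real. (integral_mean s f \<longlongrightarrow> L) (at_left 1))}"

text \<open>\<open>dA = dx dy / \<pi>\<close>\<close>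

definition area_measure :: "complex measure" where
  "area_measure = density lborel (\<lambda>_. ennreal (1 / pi))"

text \<open>The \<open>s\<close>-th power of the norm of the space \<open>D\<^sup>s\<^sub>\<alpha>\<close>, \<open>\<alpha> = s - 1\<close>, with values in \<open>[0,\<infinity>]\<close>.\<close>

definition dirichlet_norm_powr :: "real \<Rightarrow> (complex \<Rightarrow> complex) \<Rightarrow> ennreal" where
  "dirichlet_norm_powr s f =
     (\<integral>\<^sup>+z\<in>ball 0 1. ennreal (cmod (deriv f z) powr s * (1 - (cmod z)\<^sup>2) powr (s - 1)) \<partial>area_measure)
     + ennreal (cmod (f 0) powr s)"

definition dirichlet_space :: "real \<Rightarrow> (complex \<Rightarrow> complex) set" where
  "dirichlet_space s = {f. f holomorphic_on ball 0 1 \<and> dirichlet_norm_powr s f < \<infinity>}"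

text \<open>The filter \<open>|z| \<rightarrow> 1\<^sup>-\<close>: a property holds eventually iff it holds on some annulus
  \<open>b < |z| < 1\<close>, so that asymptotic estimates are uniform in the argument of \<open>z\<close>.\<close>

definition at_unit_circle :: "complex filter" where
  "at_unit_circle = filtercomap cmod (at_left 1)"

end

theory Submission
  imports Defs "HOL-Complex_Analysis.Cauchy_Integral_Formula"
begin

text \<open>
  Let \<open>F\<close> be the primitive of \<open>f = f\<^sub>1 f\<^sub>2\<close> with \<open>F(0) = 0\<close>, and put \<open>q = p / (1 - p)\<close>, so that
  \<open>1/q = 1/p\<^sub>1 + 1/p\<^sub>2 - 1\<close>. The proof bounds \<open>F\<close> along each radius in the style of Hedberg's argument
  for fractional integrals. Write \<open>h = f\<^sub>1'\<close> and \<open>s = p\<^sub>1\<close>. Finiteness of the Dirichlet-type norm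
  gives two bounds for \<open>h\<close>, both consequences of the sub-mean-value inequality
  \<open>|h(w)|\<^sup>s r\<^sup>2 \<le> C \<integral>\<^bsub>B(w,r)\<^esub> |h|\<^sup>s\<close> (\<open>holomorphic_powr_submean\<close>) with \<open>r\<close> comparable to \<open>1 - |w|\<close>:

  \<^item> uniformly in \<open>w\<close>, \<open>|h(w)| \<le> A (1 - |w|)\<^bsup>-1/s-1\<^esup>\<close>, since the integral is at most the norm;

  \<^item> on the radius with direction \<open>\<theta>\<close>, \<open>|h(t e\<^bsup>i\<theta>\<^esup>)| \<le> A N(\<theta>) / (1 - t)\<close> with
    \<open>N(\<theta>)\<^sup>s = 1 + V(\<theta>)\<close>, where \<open>V(\<theta>)\<close> integrates the norm density with weight \<open>1 / (1 - |z|)\<close> over a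
    nontangential region at \<open>e\<^bsup>i\<theta>\<^esup>\<close>. A point \<open>z\<close> lies in this region for a set of \<open>\<theta>\<close> of
    measure \<open>O(1 - |z|)\<close>, so Tonelli's theorem makes \<open>V\<close> integrable
    (\<open>nn_integral_cone_integral_le\<close>, \<open>derivative_radial_majorant\<close>).

  The bounds cross at \<open>1 - t = \<delta> = N\<^bsup>-s\<^esup>\<close>. Integrating twice along the radius, with the first bound
  up to \<open>1 - \<delta>\<close> and the second one beyond, and using \<open>|f\<^sub>2(z)| \<le> B (1 - |z|)\<^bsup>-1/p\<^sub>2\<^esup>\<close>, gives
  \<open>|F(t e\<^bsup>i\<theta>\<^esup>)| \<le> C \<delta>\<^bsup>-1/q\<^esup> = C (1 + V(\<theta>))\<^bsup>1/q\<^esup>\<close> for all \<open>t < 1\<close>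
  (\<open>radial_primitive_bound\<close>). Hence \<open>|F(t e\<^bsup>i\<theta>\<^esup>)|\<^sup>q\<close> has the integrable majorant
  \<open>C\<^sup>q (1 + V(\<theta>))\<close>. The same estimates show that \<open>F\<close> has a radial limit wherever \<open>V(\<theta>)\<close> is finite,
  so dominated convergence gives the limit of the integral means
  (\<open>hardy_space_if_dominated\<close>).
\<close>

section \<open>The sub-mean-value inequality for powers of holomorphic functions\<close>

text \<open>The following argument covers all exponents at once, in particular \<open>s < 1\<close>, where \<open>x \<mapsto> x\<^sup>s\<close> is not
  convex and Jensen's inequality fails. At a maximum point \<open>z\<^sub>0\<close> of \<open>|h(z)| d(z)\<^bsup>2/s\<^esup>\<close>, where \<open>d(z)\<close> is
  the distance from \<open>z\<close> to the boundary of \<open>B(w,r)\<close>, the maximum property bounds \<open>|h|\<close> by a multiple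
  of \<open>|h(z\<^sub>0)|\<close> near \<open>z\<^sub>0\<close>. Cauchy's estimate then keeps \<open>|h|\<close> above \<open>|h(z\<^sub>0)| / 2\<close> on a ball of radius
  comparable to \<open>d(z\<^sub>0)\<close>, and the integral over that ball alone dominates
  \<open>|h(z\<^sub>0)|\<^sup>s d(z\<^sub>0)\<^sup>2 \<ge> |h(w)|\<^sup>s r\<^sup>2\<close>.\<close>

lemma holomorphic_powr_submean:
  fixes s :: real
  assumes "0 < s"
  obtains C where "0 < C"
    "\<And>h S w r. h holomorphic_on S \<Longrightarrow> open S \<Longrightarrow> cball w r \<subseteq> S \<Longrightarrow> 0 < r \<Longrightarrow>
       ennreal (cmod (h w) powr s * r\<^sup>2) \<le>
         ennreal C * (\<integral>\<^sup>+z\<in>ball w r. ennreal (cmod (h z) powr s) \<partial>lborel)"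
proof
  define M :: real where "M = 2 powr (2 / s)"
  \<comment> \<open>The factor 8 makes the increment of \<open>h\<close> on \<open>B(z\<^sub>0, c d)\<close>, at most \<open>4 M |h(z\<^sub>0)| c\<close>, equal to half of \<open>|h(z\<^sub>0)|\<close>.\<close>
  define c where "c = 1 / (8 * M)"
  have M1: "1 \<le> M"
    unfolding M_def using assms by (intro ge_one_powr_ge_zero) auto
  have c: "0 < c" "c \<le> 1 / 8"
    using M1 by (auto simp: c_def field_simps)
  define C where "C = 2 powr s / (pi * c\<^sup>2)"
  show "0 < C"
    using c by (simp add: C_def)
  fix h S w r
  assume hol: "h holomorphic_on S" and S: "open S" "cball w r \<subseteq> S" and r: "(0::real) < r"
  show "ennreal (cmod (h w) powr s * r\<^sup>2) \<le>
         ennreal C * (\<integral>\<^sup>+z\<in>ball w r. ennreal (cmod (h z) powr s) \<partial>lborel)"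
  proof (cases "h w = 0")
    case True
    then show ?thesis by simp
  next
    case False
    define g where "g = (\<lambda>z. cmod (h z) * (r - dist w z) powr (2 / s))"
    have conth: "continuous_on (cball w r) h"
      using hol S(2) holomorphic_on_imp_continuous_on continuous_on_subset by blast
    have "continuous_on (cball w r) g"
      unfolding g_def using assms
      by (intro continuous_intros conth continuous_on_powr') auto
    then obtain z0 where z0: "z0 \<in> cball w r" "\<And>z. z \<in> cball w r \<Longrightarrow> g z \<le> g z0"
      using continuous_attains_sup[of "cball w r" g] r by fastforce
    define d where "d = r - dist w z0"
    have "0 < g w"
      using False r by (simp add: g_def)
    also have "g w \<le> g z0"
      using z0(2) r by simp
    finally have g0: "0 < g z0" .
    have hz0: "0 < cmod (h z0)"
      using g0 by (auto simp: g_def)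
    have "d \<noteq> 0"
      using g0 by (auto simp: g_def d_def)
    then have d: "0 < d"
      using z0(1) by (auto simp: d_def)
    have sub: "cball z0 (d / 2) \<subseteq> cball w r"
    proof
      fix u assume "u \<in> cball z0 (d / 2)"
      then show "u \<in> cball w r"
        using dist_triangle[of w u z0] d by (simp add: d_def)
    qed
    have bound: "cmod (h u) \<le> M * cmod (h z0)" if u: "u \<in> cball z0 (d / 2)" for u
    proof -
      have du: "d / 2 \<le> r - dist w u"
        using dist_triangle[of w u z0] u by (simp add: d_def)
      have "cmod (h u) * (d / 2) powr (2 / s) \<le> cmod (h u) * (r - dist w u) powr (2 / s)"
        using du d assms by (intro mult_left_mono powr_mono2) auto
      also have "\<dots> \<le> cmod (h z0) * d powr (2 / s)"
        using z0(2)[of u] sub u by (auto simp: g_def d_def)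
      also have "d powr (2 / s) = M * (d / 2) powr (2 / s)"
        using d by (simp add: M_def flip: powr_mult)
      finally have "cmod (h u) * (d / 2) powr (2 / s) \<le> (M * cmod (h z0)) * (d / 2) powr (2 / s)"
        by (simp add: mult_ac)
      then show ?thesis
        using d by (simp add: mult_le_cancel_right)
    qed
    have holsub: "h holomorphic_on ball z0 (d / 2)"
      using hol S(2) sub by (meson ball_subset_cball holomorphic_on_subset order_trans)
    have deriv_bound: "cmod (deriv h u) \<le> 4 * M * cmod (h z0) / d" if u: "u \<in> ball z0 (d / 4)" for u
    proof -
      have sub': "cball u (d / 4) \<subseteq> ball z0 (d / 2)"
      proof
        fix v assume "v \<in> cball u (d / 4)"
        then show "v \<in> ball z0 (d / 2)"
          using dist_triangle[of z0 v u] u by simp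
      qed
      have "cmod ((deriv ^^ 1) h u) \<le> fact 1 * (M * cmod (h z0)) / (d / 4) ^ 1"
      proof (rule Cauchy_inequality)
        show "h holomorphic_on ball u (d / 4)"
          using holsub sub' by (meson ball_subset_cball holomorphic_on_subset order_trans)
        show "continuous_on (cball u (d / 4)) h"
          using holsub sub' holomorphic_on_imp_continuous_on continuous_on_subset by blast
        show "norm (h x) \<le> M * cmod (h z0)" if "norm (u - x) = d / 4" for x
          using that sub' by (intro bound) (auto simp: subset_iff dist_norm)
      qed (use d in auto)
      then show ?thesis
        by (simp add: field_simps)
    qed
    have lower: "cmod (h z0) / 2 \<le> cmod (h u)" if u: "u \<in> ball z0 (c * d)" for u
    proof -
      have cd: "c * d \<le> d / 8"
        using c d by (simp add: field_simps)
      have uu: "u \<in> ball z0 (d / 4)"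
        using u cd d unfolding mem_ball by linarith
      have "cmod (h u - h z0) \<le> (4 * M * cmod (h z0) / d) * cmod (u - z0)"
      proof (rule field_differentiable_bound)
        show "(h has_field_derivative deriv h z) (at z within ball z0 (d / 4))"
          if "z \<in> ball z0 (d / 4)" for z
          using that d
          by (intro has_field_derivative_at_within[OF holomorphic_derivI[OF holsub open_ball]]) auto
      qed (use deriv_bound uu d in auto)
      also have "\<dots> \<le> (4 * M * cmod (h z0) / d) * (c * d)"
        using u d M1 by (intro mult_left_mono) (auto simp: dist_norm norm_minus_commute)
      also have "\<dots> = cmod (h z0) / 2"
        using d M1 by (simp add: c_def field_simps)
      finally show ?thesis
        using norm_triangle_ineq2[of "h z0" "h u"] by (simp add: norm_minus_commute)
    qed
    have subr: "ball z0 (c * d) \<subseteq> ball w r"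
    proof
      fix u assume u: "u \<in> ball z0 (c * d)"
      have "c * d \<le> d / 8"
        using c d by (simp add: field_simps)
      then show "u \<in> ball w r"
        using dist_triangle[of w u z0] u d d_def unfolding mem_ball by linarith
    qed
    have "ennreal (cmod (h w) powr s * r\<^sup>2) = ennreal (g w powr s)"
      using r assms by (simp add: g_def powr_mult powr_powr powr_numeral)
    also have "\<dots> \<le> ennreal (g z0 powr s)"
      using z0(2)[of w] r assms \<open>0 < g w\<close> by (intro ennreal_leI powr_mono2) auto
    also have "g z0 powr s = C * ((cmod (h z0) / 2) powr s * (pi * (c * d)\<^sup>2))"
      using d assms c
      by (simp add: g_def C_def d_def powr_mult powr_divide powr_powr powr_numeral power_mult_distrib)
    also have "ennreal \<dots> = ennreal C * (ennreal ((cmod (h z0) / 2) powr s) * emeasure lborel (ball z0 (c * d)))"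
      using c d \<open>0 < C\<close>
      by (simp add: emeasure_ball unit_ball_vol_2 ennreal_mult DIM_complex)
    also have "\<dots> = ennreal C * (\<integral>\<^sup>+z\<in>ball z0 (c * d). ennreal ((cmod (h z0) / 2) powr s) \<partial>lborel)"
      by (simp add: nn_integral_cmult_indicator)
    also have "\<dots> \<le> ennreal C * (\<integral>\<^sup>+z\<in>ball w r. ennreal (cmod (h z) powr s) \<partial>lborel)"
      using lower subr assms
      by (intro mult_left_mono nn_integral_mono) (auto simp: indicator_def intro!: ennreal_leI powr_mono2)
    finally show ?thesis .
  qed
qed

section \<open>Lengths of arcs cut out by balls\<close>

lemma sin_ge_linear:
  fixes x :: real
  assumes "0 \<le> x" "x \<le> pi / 2"
  shows "x / 2 \<le> sin x"
proof -
  have "convex_on {0..pi / 2} (\<lambda>x. - sin x)"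
    by (rule f''_ge0_imp_convex[where f' = "\<lambda>x. - cos x" and f'' = "\<lambda>x. sin x"])
       (auto intro!: derivative_eq_intros sin_ge_zero)
  from convex_onD_Icc[OF this, of "x / (pi / 2)"] assms
  have "x / (pi / 2) \<le> sin x"
    by simp
  moreover have "x / 2 \<le> x / (pi / 2)"
    using assms pi_less_4 by (intro divide_left_mono) auto
  ultimately show ?thesis by linarith
qed

text \<open>The two ends of \<open>[0, 2\<pi>]\<close> parametrise the same point, so a short chord means that the parameters
  are close or that they lie near opposite ends.\<close>

lemma chord_arc:
  assumes "\<theta> \<in> {0..2 * pi}" "\<phi> \<in> {0..2 * pi}" "cmod (cis \<theta> - cis \<phi>) < \<eta>"
  shows "\<bar>\<theta> - \<phi>\<bar> \<le> 2 * \<eta> \<or> 2 * pi - 2 * \<eta> \<le> \<bar>\<theta> - \<phi>\<bar>"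
proof -
  define x where "x = \<bar>\<theta> - \<phi>\<bar> / 2"
  have x: "0 \<le> x" "x \<le> pi"
    using assms by (auto simp: x_def)
  have "cis \<theta> - cis \<phi> = cis \<phi> * (cis (\<theta> - \<phi>) - 1)"
    by (simp add: algebra_simps cis_mult)
  then have "cmod (cis \<theta> - cis \<phi>) = cmod (cis (\<theta> - \<phi>) - 1)"
    by (simp add: norm_mult)
  also have "\<dots> = 2 * \<bar>sin ((\<theta> - \<phi>) / 2)\<bar>"
    using dist_exp_i_1[of "\<theta> - \<phi>"] by (simp add: cis_conv_exp)
  also have "\<bar>sin ((\<theta> - \<phi>) / 2)\<bar> = sin x"
  proof -
    have "x = (\<theta> - \<phi>) / 2 \<or> x = - ((\<theta> - \<phi>) / 2)"
      by (cases "\<theta> \<ge> \<phi>") (simp_all add: x_def field_simps)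
    then have "\<bar>sin ((\<theta> - \<phi>) / 2)\<bar> = \<bar>sin x\<bar>"
      by (metis abs_minus_cancel sin_minus)
    then show ?thesis using x sin_ge_zero[of x] by simp
  qed
  finally have *: "2 * sin x < \<eta>"
    using assms by simp
  show ?thesis
  proof (cases "x \<le> pi / 2")
    case True
    then show ?thesis
      using sin_ge_linear[of x] x * by (simp add: x_def)
  next
    case False
    then show ?thesis
      using sin_ge_linear[of "pi - x"] x * by (simp add: x_def)
  qed
qed

text \<open>All parameters of the arc lie within \<open>4\<epsilon>\<close> of one of them, up to a shift by \<open>2\<pi>\<close> in either
  direction; the unshifted interval has length \<open>8\<epsilon>\<close> and each shifted one meets \<open>[0, 2\<pi>]\<close>
  in length at most \<open>4\<epsilon>\<close>.\<close>

lemma emeasure_arc_le: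
  assumes "0 < \<epsilon>"
  shows "emeasure lborel {\<theta> \<in> {0..2 * pi}. cmod (z - cis \<theta>) < \<epsilon>} \<le> ennreal (16 * \<epsilon>)"
    (is "emeasure lborel ?E \<le> _")
proof (cases "?E = {}")
  case True
  show ?thesis unfolding True by simp
next
  case False
  then obtain \<phi> where \<phi>: "\<phi> \<in> {0..2 * pi}" "cmod (z - cis \<phi>) < \<epsilon>"
    by auto
  let ?A = "{\<phi> - 4 * \<epsilon>..\<phi> + 4 * \<epsilon>}"
    and ?B = "{\<phi> + 2 * pi - 4 * \<epsilon>..\<phi> + 2 * pi}"
    and ?D = "{\<phi> - 2 * pi..\<phi> - 2 * pi + 4 * \<epsilon>}"
  have "?E \<subseteq> ?A \<union> ?B \<union> ?D"
  proof
    fix \<theta> assume \<theta>: "\<theta> \<in> ?E"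
    have "cmod (cis \<theta> - cis \<phi>) < 2 * \<epsilon>"
      using \<theta> \<phi> norm_triangle_ineq[of "cis \<theta> - z" "z - cis \<phi>"] by (simp add: norm_minus_commute)
    with chord_arc[of \<theta> \<phi> "2 * \<epsilon>"] \<theta> \<phi>
    show "\<theta> \<in> ?A \<union> ?B \<union> ?D"
      by (auto simp: abs_real_def split: if_splits)
  qed
  then have "emeasure lborel ?E \<le> emeasure lborel (?A \<union> ?B \<union> ?D)"
    by (intro emeasure_mono) auto
  also have "\<dots> \<le> emeasure lborel ?A + emeasure lborel ?B + emeasure lborel ?D"
    by (intro order_trans[OF emeasure_subadditive] add_right_mono emeasure_subadditive) auto
  also have "\<dots> = ennreal (16 * \<epsilon>)"
    using assms by (simp flip: ennreal_plus)
  finally show ?thesis .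
qed

section \<open>Integration over nontangential regions\<close>

text \<open>A nontangential approach region at \<open>e\<^bsup>i\<theta>\<^esup>\<close>. The aperture 3 is large enough for the region to
  contain the ball of radius \<open>(1 - t) / 2\<close> about each point \<open>t e\<^bsup>i\<theta>\<^esup>\<close> of the radius.\<close>

definition stolz_region :: "real \<Rightarrow> complex set" where
  "stolz_region \<theta> = {z \<in> ball 0 1. cmod (z - cis \<theta>) < 3 * (1 - cmod z)}"

lemma open_stolz_graph: "open {x :: real \<times> complex. snd x \<in> stolz_region (fst x)}"
  unfolding stolz_region_def mem_ball dist_0_norm mem_Collect_eq cis_conv_exp
  by (intro open_Collect_conj open_Collect_less continuous_intros)

text \<open>The weight is the reciprocal of the length of the arc of those \<open>\<theta>\<close> whose region contains \<open>z\<close>,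
  up to a constant factor, so that integration over \<open>\<theta>\<close> recovers the area integral of \<open>G\<close>.\<close>

definition cone_integral :: "(complex \<Rightarrow> ennreal) \<Rightarrow> real \<Rightarrow> ennreal" where
  "cone_integral G \<theta> = (\<integral>\<^sup>+z\<in>stolz_region \<theta>. G z * ennreal (1 / (1 - cmod z)) \<partial>lborel)"

lemma measurable_cone_integrand:
  assumes [measurable]: "G \<in> borel_measurable borel"
  shows "(\<lambda>(\<theta>, z). G z * ennreal (1 / (1 - cmod z)) * indicator (stolz_region \<theta>) z)
           \<in> borel_measurable (lborel \<Otimes>\<^sub>M lborel)"
proof -
  have [measurable]: "{x :: real \<times> complex. snd x \<in> stolz_region (fst x)} \<in> sets borel"
    using open_stolz_graph by (rule borel_open)
  have "(\<lambda>x :: real \<times> complex. G (snd x) * ennreal (1 / (1 - cmod (snd x))) *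
           indicator {x. snd x \<in> stolz_region (fst x)} x) \<in> borel_measurable borel"
    unfolding borel_prod[symmetric] by measurable (simp_all add: borel_prod)
  also have "borel_measurable borel = borel_measurable (lborel \<Otimes>\<^sub>M (lborel :: complex measure))"
    by (simp add: lborel_prod)
  finally show ?thesis
    by (simp add: case_prod_beta' indicator_def)
qed

lemma borel_measurable_cone_integral:
  assumes "G \<in> borel_measurable borel"
  shows "cone_integral G \<in> borel_measurable borel"
  using lborel.borel_measurable_nn_integral[OF measurable_cone_integrand[OF assms]]
  unfolding cone_integral_def by simp

text \<open>After exchanging the integrals, the inner one is the measure of the arc
  \<open>|z - e\<^bsup>i\<theta>\<^esup>| < 3 (1 - |z|)\<close>, at most \<open>16 \<cdot> 3 (1 - |z|)\<close> by \<open>emeasure_arc_le\<close>; the weight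
  cancels the factor \<open>1 - |z|\<close>.\<close>

lemma nn_integral_cone_integral_le:
  assumes G[measurable]: "G \<in> borel_measurable borel"
  shows "(\<integral>\<^sup>+\<theta>\<in>{0..2 * pi}. cone_integral G \<theta> \<partial>lborel) \<le> 48 * (\<integral>\<^sup>+z\<in>ball 0 1. G z \<partial>lborel)"
proof -
  define \<Phi> where "\<Phi> = (\<lambda>\<theta> z. G z * ennreal (1 / (1 - cmod z)) * indicator (stolz_region \<theta>) z)"
  have \<Phi>[measurable]: "case_prod \<Phi> \<in> borel_measurable (lborel \<Otimes>\<^sub>M lborel)"
    unfolding \<Phi>_def by (rule measurable_cone_integrand[OF G])
  have sec: "(\<lambda>\<theta>. \<Phi> \<theta> z) \<in> borel_measurable lborel" "\<Phi> \<theta> \<in> borel_measurable lborel" for z \<theta>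
    using \<Phi> by measurable
  have "(\<integral>\<^sup>+\<theta>\<in>{0..2 * pi}. cone_integral G \<theta> \<partial>lborel)
      = (\<integral>\<^sup>+\<theta>. (\<integral>\<^sup>+z. \<Phi> \<theta> z * indicator {0..2 * pi} \<theta> \<partial>lborel) \<partial>lborel)"
    using sec by (subst nn_integral_multc) (auto simp: cone_integral_def \<Phi>_def)
  also have "\<dots> = (\<integral>\<^sup>+z. (\<integral>\<^sup>+\<theta>. \<Phi> \<theta> z * indicator {0..2 * pi} \<theta> \<partial>lborel) \<partial>lborel)"
    by (rule lborel_pair.Fubini'[symmetric]) measurable
  also have "\<dots> \<le> (\<integral>\<^sup>+z. 48 * (G z * indicator (ball 0 1) z) \<partial>lborel)"
  proof (rule nn_integral_mono)
    fix z :: complex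
    show "(\<integral>\<^sup>+\<theta>. \<Phi> \<theta> z * indicator {0..2 * pi} \<theta> \<partial>lborel) \<le> 48 * (G z * indicator (ball 0 1) z)"
    proof (cases "cmod z < 1")
      case False
      then have "\<Phi> \<theta> z = 0" for \<theta>
        by (simp add: \<Phi>_def stolz_region_def)
      then show ?thesis by simp
    next
      case True
      let ?E = "{\<theta> \<in> {0..2 * pi}. cmod (z - cis \<theta>) < 3 * (1 - cmod z)}"
      have "open {\<theta>. cmod (z - cis \<theta>) < 3 * (1 - cmod z)}"
        unfolding cis_conv_exp by (intro open_Collect_less continuous_intros)
      then have "{\<theta>. cmod (z - cis \<theta>) < 3 * (1 - cmod z)} \<in> sets borel"
        by (rule borel_open)
      then have "{0..2 * pi} \<inter> {\<theta>. cmod (z - cis \<theta>) < 3 * (1 - cmod z)} \<in> sets borel"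
        by (rule sets.Int[rotated]) simp
      moreover have "?E = {0..2 * pi} \<inter> {\<theta>. cmod (z - cis \<theta>) < 3 * (1 - cmod z)}"
        by blast
      ultimately have E: "?E \<in> sets lborel"
        unfolding sets_lborel by (simp only:)
      have "(\<integral>\<^sup>+\<theta>. \<Phi> \<theta> z * indicator {0..2 * pi} \<theta> \<partial>lborel)
          = (\<integral>\<^sup>+\<theta>. G z * ennreal (1 / (1 - cmod z)) * indicator ?E \<theta> \<partial>lborel)"
        using True by (intro nn_integral_cong) (auto simp: \<Phi>_def stolz_region_def indicator_def)
      also have "\<dots> = G z * ennreal (1 / (1 - cmod z)) * emeasure lborel ?E"
        using E by (rule nn_integral_cmult_indicator)
      also have "\<dots> \<le> G z * ennreal (1 / (1 - cmod z)) * ennreal (16 * (3 * (1 - cmod z)))"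
        using True by (intro mult_left_mono emeasure_arc_le) auto
      also have "\<dots> = G z * ennreal (1 / (1 - cmod z) * (16 * (3 * (1 - cmod z))))"
        using True by (subst ennreal_mult) (auto simp: mult.assoc)
      also have "1 / (1 - cmod z) * (16 * (3 * (1 - cmod z))) = 48"
        using True by (simp add: field_simps)
      finally show ?thesis
        using True by (simp add: mult.commute)
    qed
  qed
  also have "\<dots> = 48 * (\<integral>\<^sup>+z\<in>ball 0 1. G z \<partial>lborel)"
    by (rule nn_integral_cmult) (auto intro!: borel_measurable_times_ennreal borel_measurable_indicator)
  finally show ?thesis .
qed

section \<open>Pointwise bounds for the derivative\<close>

text \<open>On a ball whose radius is half the distance of its centre to the unit circle, powers of that
  distance vary only by a constant factor.\<close>

lemma whitney_ball:
  assumes w: "cmod w < 1" and r: "2 * r = 1 - cmod w" and z: "z \<in> ball w r"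
  shows "cmod z < 1" "r \<le> 1 - cmod z" "1 - cmod z \<le> 3 * r"
    "r \<le> 1 - (cmod z)\<^sup>2" "1 - (cmod z)\<^sup>2 \<le> 6 * r"
proof -
  have "cmod z \<le> cmod w + r" "cmod w \<le> cmod z + r"
    using z norm_triangle_ineq2[of z w] norm_triangle_ineq3[of w z] by (auto simp: dist_norm norm_minus_commute)
  then have "cmod z < 1 \<and> r \<le> 1 - cmod z \<and> 1 - cmod z \<le> 3 * r"
    using w r by linarith
  then show *: "cmod z < 1" "r \<le> 1 - cmod z" "1 - cmod z \<le> 3 * r"
    by blast+
  have "(cmod z)\<^sup>2 \<le> cmod z"
    using * by (simp add: power2_eq_square mult_left_le)
  moreover have "0 \<le> 1 - 2 * cmod z + (cmod z)\<^sup>2"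
    using zero_le_power2[of "1 - cmod z"] by (simp add: power2_diff)
  ultimately have "r \<le> 1 - (cmod z)\<^sup>2 \<and> 1 - (cmod z)\<^sup>2 \<le> 6 * r"
    using * by linarith
  then show "r \<le> 1 - (cmod z)\<^sup>2" "1 - (cmod z)\<^sup>2 \<le> 6 * r"
    by blast+
qed

lemma powr_le_comparable:
  fixes x r c :: real
  assumes "0 < r" "r \<le> x" "x \<le> c * r"
  shows "r powr b \<le> c powr \<bar>b\<bar> * x powr b"
proof -
  have x: "0 < x" "1 \<le> x / r" "x / r \<le> c"
    using assms by (auto simp: field_simps)
  have "(x / r) powr (- b) \<le> (x / r) powr \<bar>b\<bar>"
    using x by (intro powr_mono) auto
  also have "\<dots> \<le> c powr \<bar>b\<bar>"
    using x by (intro powr_mono2) auto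
  finally show ?thesis
    using x assms by (simp add: powr_divide powr_minus field_simps)
qed

lemma borel_measurable_indicator_continuous_on:
  fixes g :: "'a::topological_space \<Rightarrow> real"
  assumes "open S" "continuous_on S g"
  shows "(\<lambda>z. ennreal (g z) * indicator S z) \<in> borel_measurable borel"
proof -
  have "(\<lambda>z. indicator S z *\<^sub>R g z) \<in> borel_measurable borel"
    using assms by (intro borel_measurable_continuous_on_indicator) auto
  then have "(\<lambda>z. ennreal (indicator S z *\<^sub>R g z)) \<in> borel_measurable borel"
    by measurable
  also have "(\<lambda>z. ennreal (indicator S z *\<^sub>R g z)) = (\<lambda>z. ennreal (g z) * indicator S z)"
    by (auto simp: indicator_def)
  finally show ?thesis .
qed

text \<open>The integrand of the Dirichlet-type norm for a function with derivative \<open>h\<close>, extended by zero outside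
  the disc so that it is measurable on the whole plane.\<close>

definition dirichlet_density :: "real \<Rightarrow> (complex \<Rightarrow> complex) \<Rightarrow> complex \<Rightarrow> ennreal" where
  "dirichlet_density s h z =
     ennreal (cmod (h z) powr s * (1 - (cmod z)\<^sup>2) powr (s - 1)) * indicator (ball 0 1) z"

lemma borel_measurable_dirichlet_density:
  assumes "0 < s" "h holomorphic_on ball 0 1"
  shows "dirichlet_density s h \<in> borel_measurable borel"
proof -
  have "1 - (cmod z)\<^sup>2 \<noteq> 0" if "z \<in> ball 0 1" for z
    using abs_square_less_1[of "cmod z"] that by auto
  then have "continuous_on (ball 0 1) (\<lambda>z. cmod (h z) powr s * (1 - (cmod z)\<^sup>2) powr (s - 1))"
    using assms
    by (intro continuous_intros continuous_on_powr' holomorphic_on_imp_continuous_on) auto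
  then show ?thesis
    unfolding dirichlet_density_def [abs_def]
    by (intro borel_measurable_indicator_continuous_on) auto
qed

text \<open>The sub-mean-value inequality on a Whitney ball, where the weight \<open>(1 - |z|\<^sup>2)\<^bsup>s-1\<^esup>\<close> may be
  moved inside the integral because it is comparable to \<open>r\<^bsup>s-1\<^esup>\<close>.\<close>

lemma derivative_local_bound:
  fixes s :: real
  assumes s: "0 < s" and h: "h holomorphic_on ball 0 1"
  obtains C where "0 < C"
    "\<And>w. w \<in> ball 0 1 \<Longrightarrow>
       ennreal (cmod (h w) powr s * ((1 - cmod w) / 2) powr (s + 1)) \<le>
         ennreal C * (\<integral>\<^sup>+z\<in>ball w ((1 - cmod w) / 2). dirichlet_density s h z \<partial>lborel)"
proof -
  obtain C where C: "0 < C"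
    "\<And>h S w r. h holomorphic_on S \<Longrightarrow> open S \<Longrightarrow> cball w r \<subseteq> S \<Longrightarrow> 0 < r \<Longrightarrow>
       ennreal (cmod (h w) powr s * r\<^sup>2) \<le>
         ennreal C * (\<integral>\<^sup>+z\<in>ball w r. ennreal (cmod (h z) powr s) \<partial>lborel)"
    using holomorphic_powr_submean[OF s] by blast
  define D where "D = (6::real) powr \<bar>s - 1\<bar>"
  have D: "0 < D" by (simp add: D_def)
  have hc: "continuous_on (ball 0 1) h"
    using h by (rule holomorphic_on_imp_continuous_on)
  note [measurable] = borel_measurable_dirichlet_density[OF s h]
  have "ennreal (cmod (h w) powr s * ((1 - cmod w) / 2) powr (s + 1)) \<le>
         ennreal (C * D) * (\<integral>\<^sup>+z\<in>ball w ((1 - cmod w) / 2). dirichlet_density s h z \<partial>lborel)"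
    if w: "w \<in> ball 0 1" for w
  proof -
    define r where "r = (1 - cmod w) / 2"
    have r: "0 < r" using w by (simp add: r_def)
    have r2: "2 * r = 1 - cmod w" by (simp add: r_def)
    have sub: "cball w r \<subseteq> ball 0 1"
    proof
      fix z assume "z \<in> cball w r"
      then have "cmod (w - z) \<le> r"
        by (simp add: dist_norm)
      then show "z \<in> ball 0 1"
        using norm_triangle_ineq2[of z w] r r2 unfolding mem_ball_0 norm_minus_commute[of w z]
        by linarith
    qed
    have "continuous_on (ball w r) (\<lambda>z. cmod (h z) powr s)"
      using sub s by (intro continuous_intros continuous_on_powr' continuous_on_subset[OF hc]) auto
    then have [measurable]: "(\<lambda>z. ennreal (cmod (h z) powr s) * indicator (ball w r) z) \<in> borel_measurable borel"
      by (intro borel_measurable_indicator_continuous_on) auto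
    have "ennreal (cmod (h w) powr s * r powr (s + 1))
        = ennreal (cmod (h w) powr s * r\<^sup>2) * ennreal (r powr (s - 1))"
    proof -
      have "r powr (s + 1) = r powr 2 * r powr (s - 1)"
        by (simp add: add.commute flip: powr_add)
      then show ?thesis
        using r by (simp add: mult.assoc flip: ennreal_mult)
    qed
    also have "\<dots> \<le> ennreal C * (\<integral>\<^sup>+z\<in>ball w r. ennreal (cmod (h z) powr s) \<partial>lborel) * ennreal (r powr (s - 1))"
      by (intro mult_right_mono C(2)[OF h open_ball sub r]) auto
    also have "\<dots> = ennreal C * (\<integral>\<^sup>+z. ennreal (cmod (h z) powr s) * indicator (ball w r) z * ennreal (r powr (s - 1)) \<partial>lborel)"
      by (subst nn_integral_multc) (auto simp: mult.assoc)
    also have "\<dots> \<le> ennreal C * (\<integral>\<^sup>+z. ennreal D * (dirichlet_density s h z * indicator (ball w r) z) \<partial>lborel)"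
    proof (intro mult_left_mono nn_integral_mono)
      fix z
      show "ennreal (cmod (h z) powr s) * indicator (ball w r) z * ennreal (r powr (s - 1))
          \<le> ennreal D * (dirichlet_density s h z * indicator (ball w r) z)"
      proof (cases "z \<in> ball w r")
        case True
        note wz = whitney_ball[OF _ r2 True]
        have "r powr (s - 1) \<le> D * (1 - (cmod z)\<^sup>2) powr (s - 1)"
          unfolding D_def using wz r w by (intro powr_le_comparable) auto
        from mult_left_mono[OF this, of "cmod (h z) powr s"]
        have "cmod (h z) powr s * r powr (s - 1) \<le> D * (cmod (h z) powr s * (1 - (cmod z)\<^sup>2) powr (s - 1))"
          by (simp add: mult.left_commute)
        moreover have "z \<in> ball 0 1" using wz w by simp
        ultimately show ?thesis
          using True D by (simp add: dirichlet_density_def flip: ennreal_mult)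
      qed simp
    qed simp
    also have "\<dots> = ennreal (C * D) * (\<integral>\<^sup>+z\<in>ball w r. dirichlet_density s h z \<partial>lborel)"
      using C(1) D borel_measurable_dirichlet_density[OF s h]
      by (subst nn_integral_cmult)
        (auto simp: ennreal_mult mult.assoc intro!: borel_measurable_times_ennreal borel_measurable_indicator)
    finally show ?thesis unfolding r_def .
  qed
  then show thesis
    using that[of "C * D"] C(1) D by simp
qed

text \<open>Two ways to continue \<open>derivative_local_bound\<close>: enlarging the ball to the whole disc gives the uniform
  bound, enlarging it to the nontangential region gives the bound on the radius, with one power of
  \<open>1 - t\<close> gained from the weight in \<open>cone_integral\<close>. Using \<open>1 + V\<close> in place of \<open>V\<close> makes the
  radial majorant at least 1, as \<open>radial_primitive_bound\<close> requires.\<close>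

lemma derivative_radial_majorant:
  fixes s :: real
  assumes s: "0 < s" and h: "h holomorphic_on ball 0 1"
    and fin: "(\<integral>\<^sup>+z. dirichlet_density s h z \<partial>lborel) < \<infinity>"
  obtains A V where "0 \<le> A" "\<And>\<theta>. 0 \<le> V \<theta>" "set_integrable lborel {0..2 * pi} V"
    "\<And>w. w \<in> ball 0 1 \<Longrightarrow> cmod (h w) \<le> A * (1 - cmod w) powr (- (1 / s) - 1)"
    "AE \<theta> in lborel. \<theta> \<in> {0..2 * pi} \<longrightarrow>
       (\<forall>t\<in>{0..<1}. cmod (h (of_real t * cis \<theta>)) \<le> A * (1 + V \<theta>) powr (1 / s) / (1 - t))"
proof -
  obtain C where C: "0 < C"
    "\<And>w. w \<in> ball 0 1 \<Longrightarrow>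
       ennreal (cmod (h w) powr s * ((1 - cmod w) / 2) powr (s + 1)) \<le>
         ennreal C * (\<integral>\<^sup>+z\<in>ball w ((1 - cmod w) / 2). dirichlet_density s h z \<partial>lborel)"
    using derivative_local_bound[OF s h] by blast
  note G[measurable] = borel_measurable_dirichlet_density[OF s h]
  define I where "I = enn2real (\<integral>\<^sup>+z. dirichlet_density s h z \<partial>lborel)"
  have I: "0 \<le> I" "(\<integral>\<^sup>+z. dirichlet_density s h z \<partial>lborel) = ennreal I"
    using fin by (auto simp: I_def ennreal_enn2real_if)
  define W where "W = cone_integral (dirichlet_density s h)"
  define V where "V = (\<lambda>\<theta>. enn2real (W \<theta>))"
  have W[measurable]: "W \<in> borel_measurable borel"
    unfolding W_def by (rule borel_measurable_cone_integral[OF G])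
  have "(\<integral>\<^sup>+z\<in>ball 0 1. dirichlet_density s h z \<partial>lborel) = ennreal I"
    unfolding I(2)[symmetric] by (intro nn_integral_cong) (simp add: dirichlet_density_def mult.assoc indicator_def)
  then have Wint: "(\<integral>\<^sup>+\<theta>. W \<theta> * indicator {0..2 * pi} \<theta> \<partial>lborel) < \<infinity>"
    using nn_integral_cone_integral_le[OF G] unfolding W_def
    by (metis ennreal_less_top ennreal_mult_less_top ennreal_numeral infinity_ennreal_def order_le_less_trans)
  have "set_integrable lborel {0..2 * pi} V"
    unfolding set_integrable_def
  proof (rule integrableI_bounded)
    have "(\<integral>\<^sup>+\<theta>. ennreal (norm (indicator {0..2 * pi} \<theta> *\<^sub>R V \<theta>)) \<partial>lborel)
        \<le> (\<integral>\<^sup>+\<theta>. W \<theta> * indicator {0..2 * pi} \<theta> \<partial>lborel)"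
      by (intro nn_integral_mono) (auto simp: V_def indicator_def ennreal_enn2real_if)
    then show "(\<integral>\<^sup>+\<theta>. ennreal (norm (indicator {0..2 * pi} \<theta> *\<^sub>R V \<theta>)) \<partial>lborel) < \<infinity>"
      using Wint by (rule order_le_less_trans)
  qed (simp add: V_def)
  moreover
  define A1 where "A1 = (C * I) powr (1 / s) * 2 powr (1 / s + 1)"
  define A2 where "A2 = 2 * (3 * C) powr (1 / s)"
  have bound1: "cmod (h w) \<le> A1 * (1 - cmod w) powr (- (1 / s) - 1)" if w: "w \<in> ball 0 1" for w
  proof -
    define r where "r = (1 - cmod w) / 2"
    have r: "0 < r" using w by (simp add: r_def)
    have r2: "2 * r = 1 - cmod w" by (simp add: r_def)
    have "ennreal (cmod (h w) powr s * r powr (s + 1)) \<le> ennreal C * (\<integral>\<^sup>+z\<in>ball w r. dirichlet_density s h z \<partial>lborel)"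
      unfolding r_def using C(2)[OF w] .
    also have "\<dots> \<le> ennreal C * ennreal I"
      unfolding I(2)[symmetric] by (intro mult_left_mono nn_integral_mono) (auto simp: indicator_def)
    finally have "cmod (h w) powr s * r powr (s + 1) \<le> C * I"
      using C(1) I(1) by (simp flip: ennreal_mult)
    then have "(cmod (h w) powr s * r powr (s + 1)) powr (1 / s) \<le> (C * I) powr (1 / s)"
      using s by (intro powr_mono2) auto
    also have "(cmod (h w) powr s * r powr (s + 1)) powr (1 / s) = cmod (h w) * r powr (1 / s + 1)"
      using s by (simp add: powr_mult powr_powr add_divide_distrib add.commute)
    finally have "cmod (h w) * r powr (1 / s + 1) \<le> (C * I) powr (1 / s)" .
    define X where "X = (1 - cmod w) powr (1 / s + 1)"
    define T :: real where "T = 2 powr (1 / s + 1)"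
    have XT: "0 < X" "0 < T"
      using w by (auto simp: X_def T_def)
    have "r powr (1 / s + 1) = X / T"
      using w by (simp add: r_def powr_divide X_def T_def)
    then have "cmod (h w) * (X / T) \<le> (C * I) powr (1 / s)"
      using \<open>cmod (h w) * r powr (1 / s + 1) \<le> _\<close> by simp
    then have "cmod (h w) \<le> (C * I) powr (1 / s) * T * (1 / X)"
      using XT by (simp add: field_simps)
    moreover have "(1 - cmod w) powr (- (1 / s) - 1) = 1 / X"
      using powr_minus_divide[of "1 - cmod w" "1 / s + 1"] by (simp add: X_def)
    ultimately show ?thesis
      by (simp add: A1_def T_def)
  qed
  have bound2: "cmod (h w) \<le> A2 * (1 + V \<theta>) powr (1 / s) / (1 - t)"
    if t: "0 \<le> t" "t < 1" and w_eq: "w = of_real t * cis \<theta>" and fW: "W \<theta> < \<infinity>" for \<theta> t w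
  proof -
    have nw: "cmod w = t" using t by (simp add: w_eq norm_mult)
    then have w: "w \<in> ball 0 1" using t by simp
    define r where "r = (1 - cmod w) / 2"
    have r: "0 < r" using w by (simp add: r_def)
    have r2: "2 * r = 1 - cmod w" by (simp add: r_def)
    have WV: "W \<theta> = ennreal (V \<theta>)" "0 \<le> V \<theta>"
      using fW by (auto simp: V_def ennreal_enn2real_if)
    have wdist: "cmod (w - cis \<theta>) = 1 - t"
    proof -
      have "w - cis \<theta> = of_real (t - 1) * cis \<theta>"
        by (simp add: w_eq algebra_simps)
      then show ?thesis using t by (simp add: norm_mult del: of_real_diff)
    qed
    have "ennreal (cmod (h w) powr s * r powr (s + 1)) \<le> ennreal C * (\<integral>\<^sup>+z\<in>ball w r. dirichlet_density s h z \<partial>lborel)"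
      unfolding r_def using C(2)[OF w] .
    also have "\<dots> \<le> ennreal C * (\<integral>\<^sup>+z. ennreal (3 * r) * (dirichlet_density s h z * ennreal (1 / (1 - cmod z)) * indicator (stolz_region \<theta>) z) \<partial>lborel)"
    proof (intro mult_left_mono nn_integral_mono)
      fix z
      show "dirichlet_density s h z * indicator (ball w r) z
        \<le> ennreal (3 * r) * (dirichlet_density s h z * ennreal (1 / (1 - cmod z)) * indicator (stolz_region \<theta>) z)"
      proof (cases "z \<in> ball w r")
        case True
        note wz = whitney_ball[OF _ r2 True]
        have "cmod (z - cis \<theta>) < r + 2 * r"
          using True wdist norm_triangle_ineq[of "z - w" "w - cis \<theta>"] nw r2
          by (simp add: dist_norm norm_minus_commute[of z w])
        then have z: "z \<in> stolz_region \<theta>"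
          using wz w by (simp add: stolz_region_def)
        have "dirichlet_density s h z * 1 \<le> dirichlet_density s h z * ennreal (3 * r * (1 / (1 - cmod z)))"
          using wz w r by (intro mult_left_mono) auto
        also have "\<dots> = ennreal (3 * r) * (dirichlet_density s h z * ennreal (1 / (1 - cmod z)))"
          using wz w r by (subst ennreal_mult) (auto simp: mult_ac)
        finally show ?thesis
          using True z by simp
      qed simp
    qed simp
    also have "\<dots> = ennreal C * (ennreal (3 * r) * W \<theta>)"
      unfolding W_def cone_integral_def
      using measurable_Pair2[OF measurable_cone_integrand[OF G], of \<theta>] by (subst nn_integral_cmult) auto
    finally have "cmod (h w) powr s * r powr (s + 1) \<le> C * (3 * r * V \<theta>)"
      using C(1) r WV by (simp flip: ennreal_mult)
    then have "cmod (h w) powr s * r powr s \<le> 3 * C * V \<theta>"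
      using r by (simp add: powr_add mult_ac mult_le_cancel_left_pos)
    also have "\<dots> \<le> 3 * C * (1 + V \<theta>)"
      using C(1) by simp
    finally have "(cmod (h w) powr s * r powr s) powr (1 / s) \<le> (3 * C * (1 + V \<theta>)) powr (1 / s)"
      using s by (intro powr_mono2) auto
    then have "cmod (h w) * r \<le> (3 * C) powr (1 / s) * (1 + V \<theta>) powr (1 / s)"
      using s r C(1) WV by (simp add: powr_mult powr_powr)
    then show ?thesis
      using t nw by (simp add: r_def A2_def field_simps)
  qed
  have "AE \<theta> in lborel. W \<theta> * indicator {0..2 * pi} \<theta> \<noteq> \<infinity>"
    using Wint by (intro nn_integral_PInf_AE) auto
  then have "AE \<theta> in lborel. \<theta> \<in> {0..2 * pi} \<longrightarrow>
       (\<forall>t\<in>{0..<1}. cmod (h (of_real t * cis \<theta>)) \<le> max A1 A2 * (1 + V \<theta>) powr (1 / s) / (1 - t))"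
  proof eventually_elim
    case (elim \<theta>)
    show ?case
    proof (intro impI ballI)
      fix t :: real assume \<theta>: "\<theta> \<in> {0..2 * pi}" and t: "t \<in> {0..<1}"
      have "cmod (h (of_real t * cis \<theta>)) \<le> A2 * (1 + V \<theta>) powr (1 / s) / (1 - t)"
        using elim \<theta> t by (intro bound2) (auto simp: less_top)
      also have "\<dots> \<le> max A1 A2 * (1 + V \<theta>) powr (1 / s) / (1 - t)"
        using t by (intro divide_right_mono mult_right_mono) auto
      finally show "cmod (h (of_real t * cis \<theta>)) \<le> max A1 A2 * (1 + V \<theta>) powr (1 / s) / (1 - t)" .
    qed
  qed
  moreover have "cmod (h w) \<le> max A1 A2 * (1 - cmod w) powr (- (1 / s) - 1)" if w: "w \<in> ball 0 1" for w
  proof -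
    have "A1 * (1 - cmod w) powr (- (1 / s) - 1) \<le> max A1 A2 * (1 - cmod w) powr (- (1 / s) - 1)"
      by (intro mult_right_mono) auto
    then show ?thesis using bound1[OF w] by linarith
  qed
  moreover have "0 \<le> max A1 A2"
    by (simp add: A2_def le_max_iff_disj)
  ultimately show thesis
    using that[of "max A1 A2" V] by (simp add: V_def)
qed

section \<open>Integration along a radius\<close>

text \<open>Comparison with the primitive \<open>(K / \<gamma>) (1 - t)\<^bsup>-\<gamma>\<^esup>\<close> of the majorant, for either sign of \<open>\<gamma>\<close>:
  positive \<open>\<gamma>\<close> gives growth estimates, negative \<open>\<gamma>\<close> gives a modulus of continuity up to \<open>t = 1\<close>.\<close>

lemma increment_le_powr:
  fixes g :: "real \<Rightarrow> 'a::real_normed_vector"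
  assumes "a \<le> b" "b < 1" "\<gamma> \<noteq> 0"
    and g: "\<And>t. a \<le> t \<Longrightarrow> t \<le> b \<Longrightarrow> (g has_vector_derivative g' t) (at t)"
    and bound: "\<And>t. a \<le> t \<Longrightarrow> t \<le> b \<Longrightarrow> norm (g' t) \<le> K * (1 - t) powr (- \<gamma> - 1)"
  shows "norm (g b - g a) \<le> K / \<gamma> * ((1 - b) powr (- \<gamma>) - (1 - a) powr (- \<gamma>))"
proof (cases "a = b")
  case False
  then have ab: "a < b" using assms by simp
  have "norm (g b - g a) \<le> K / \<gamma> * (1 - b) powr (- \<gamma>) - K / \<gamma> * (1 - a) powr (- \<gamma>)"
  proof (rule differentiable_bound_general[where f' = g', OF ab])
    show "continuous_on {a..b} g"
      using g by (intro continuous_at_imp_continuous_on ballI) (auto intro: has_vector_derivative_continuous)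
    show "continuous_on {a..b} (\<lambda>t. K / \<gamma> * (1 - t) powr (- \<gamma>))"
      using assms by (intro continuous_intros) auto
    show "((\<lambda>t. K / \<gamma> * (1 - t) powr (- \<gamma>)) has_vector_derivative K * (1 - t) powr (- \<gamma> - 1)) (at t)"
      if "a < t" "t < b" for t
      unfolding has_real_derivative_iff_has_vector_derivative[symmetric]
      using that assms by (auto intro!: derivative_eq_intros)
  qed (use g bound in auto)
  then show ?thesis by (simp add: right_diff_distrib)
qed simp

lemma convergent_at_left_if_modulus:
  fixes F :: "real \<Rightarrow> 'a::banach"
  assumes t0: "t0 < b"
    and mod: "\<And>r r'. t0 \<le> r \<Longrightarrow> r \<le> r' \<Longrightarrow> r' < b \<Longrightarrow> norm (F r' - F r) \<le> \<psi> r"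
    and \<psi>: "(\<psi> \<longlongrightarrow> 0) (at_left b)"
  shows "\<exists>l. (F \<longlongrightarrow> l) (at_left b)"
proof -
  define r where "r = (\<lambda>n. b - (b - t0) / real (Suc n))"
  have r: "t0 \<le> r n" "r n < b" for n
    using t0 mult_right_mono[of t0 b "real n"] by (auto simp: r_def field_simps)
  have rlim: "r \<longlonglongrightarrow> b"
    unfolding r_def using tendsto_diff[OF tendsto_const lim_const_over_n[of "b - t0", THEN LIMSEQ_Suc], of b] by simp
  have rleft: "filterlim r (at_left b) sequentially"
    using rlim r by (auto simp: filterlim_at intro: always_eventually)
  have rmono: "r m \<le> r n" if "m \<le> n" for m n
    using that t0 by (auto simp: r_def intro!: divide_left_mono)
  have "Cauchy (\<lambda>n. F (r n))"
  proof (rule metric_CauchyI)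
    fix e :: real assume e: "0 < e"
    have "(\<lambda>n. \<psi> (r n)) \<longlonglongrightarrow> 0"
      using filterlim_compose[OF \<psi> rleft] .
    then have "\<forall>\<^sub>F n in sequentially. \<psi> (r n) < e / 2"
      using e by (intro order_tendstoD) auto
    then obtain M where M: "\<psi> (r M) < e / 2"
      by (auto simp: eventually_sequentially)
    have *: "dist (F (r n)) (F (r M)) < e / 2" if "n \<ge> M" for n
      using mod[OF r(1) rmono[OF that] r(2)] M unfolding dist_norm by linarith
    show "\<exists>M. \<forall>m\<ge>M. \<forall>n\<ge>M. dist (F (r m)) (F (r n)) < e"
    proof (intro exI[of _ M] allI impI)
      fix m n assume "M \<le> m" "M \<le> n"
      then show "dist (F (r m)) (F (r n)) < e"
        using * by (blast intro: dist_triangle_half_l)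
    qed
  qed
  then obtain l where l: "(\<lambda>n. F (r n)) \<longlonglongrightarrow> l"
    using Cauchy_convergent convergent_def by blast
  have bound: "norm (F x - l) \<le> \<psi> x" if x: "t0 \<le> x" "x < b" for x
  proof (rule tendsto_upperbound)
    show "(\<lambda>n. norm (F x - F (r n))) \<longlonglongrightarrow> norm (F x - l)"
      by (intro tendsto_intros l)
    have "\<forall>\<^sub>F n in sequentially. x < r n"
      using order_tendstoD(1)[OF rlim] x by auto
    then show "\<forall>\<^sub>F n in sequentially. norm (F x - F (r n)) \<le> \<psi> x"
    proof eventually_elim
      case (elim n)
      show ?case
        unfolding norm_minus_commute[of "F x"] using elim by (intro mod[OF x(1) _ r(2)]) simp
    qed
  qed auto
  have "\<forall>\<^sub>F x in at_left b. norm (F x - l) \<le> \<psi> x"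
    using bound t0 by (auto simp: eventually_at_left intro!: exI[of _ t0])
  then have "((\<lambda>x. F x - l) \<longlongrightarrow> 0) (at_left b)"
    by (rule Lim_null_comparison[OF _ \<psi>])
  then show ?thesis
    by (auto simp: LIM_zero_iff)
qed

text \<open>The constant produced by integrating both power majorants: \<open>A + A / \<beta>\<close> bounds \<open>|f\<^sub>1(z)| (1 - |z|)\<^bsup>\<beta>\<^esup>\<close>, the first summand
  belongs to the part of the radius away from the circle, and the second one to the part near it, with
  \<open>(1 - a) / 2\<close> as auxiliary exponent.\<close>

definition radial_constant :: "real \<Rightarrow> real \<Rightarrow> real \<Rightarrow> real \<Rightarrow> real" where
  "radial_constant \<beta> a A B =
     B * (A + A / \<beta>) / (\<beta> + a - 1) + B * (A + A / \<beta> + A / ((1 - a) / 2)) / ((1 - a) / 2)"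

lemma radial_constant_nonneg:
  assumes "0 < \<beta>" "a < 1" "0 \<le> A" "0 \<le> B" "0 < \<beta> + a - 1"
  shows "0 \<le> radial_constant \<beta> a A B"
  using assms by (simp add: radial_constant_def)

text \<open>The one-variable core of the proof: \<open>u\<close> and \<open>F\<close> stand for \<open>f\<^sub>1\<close> and the primitive of \<open>f\<^sub>1 f\<^sub>2\<close> on one
  radius, and what matters is that the constant in the bound is independent of \<open>N\<close>. Each of the two bounds
  for \<open>u'\<close> alone is insufficient: the first makes the double integral diverge at \<open>t = 1\<close>, and the second
  gives only the first power of \<open>N\<close>, whereas \<open>\<kappa> / \<beta> < 1\<close>. Changing from the first bound to the second at the point
  where they agree, \<open>1 - t = \<delta> = N\<^bsup>-1/\<beta>\<^esup>\<close>, both parts contribute a multiple of \<open>\<delta>\<^bsup>-\<kappa>\<^esup>\<close>.\<close>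

lemma radial_primitive_bound:
  fixes \<beta> a A B \<kappa> N :: real and u u' F F' :: "real \<Rightarrow> complex"
  assumes pos: "0 < \<beta>" "a < 1" "0 \<le> A" "0 \<le> B" and \<kappa>: "\<kappa> = \<beta> + a - 1" "0 < \<kappa>"
    and N: "1 \<le> N"
    and du: "\<And>t. 0 \<le> t \<Longrightarrow> t < 1 \<Longrightarrow> (u has_vector_derivative u' t) (at t)"
    and dF: "\<And>t. 0 \<le> t \<Longrightarrow> t < 1 \<Longrightarrow> (F has_vector_derivative F' t) (at t)"
    and u0: "cmod (u 0) \<le> A" and F0: "F 0 = 0"
    and u'1: "\<And>t. 0 \<le> t \<Longrightarrow> t < 1 \<Longrightarrow> cmod (u' t) \<le> A * (1 - t) powr (- \<beta> - 1)"
    and u'2: "\<And>t. 0 \<le> t \<Longrightarrow> t < 1 \<Longrightarrow> cmod (u' t) \<le> A * N / (1 - t)"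
    and F': "\<And>t. 0 \<le> t \<Longrightarrow> t < 1 \<Longrightarrow> cmod (F' t) \<le> B * cmod (u t) * (1 - t) powr (- a)"
  shows "(\<forall>t\<in>{0..<1}. cmod (F t) \<le> radial_constant \<beta> a A B * N powr (\<kappa> / \<beta>)) \<and>
         (\<exists>l. (F \<longlongrightarrow> l) (at_left 1))"
proof -
  \<comment> \<open>Beyond \<open>1 - \<delta>\<close> the second bound would produce a logarithm. It is replaced by a power with small
    exponent \<open>\<epsilon>\<close>, chosen so that \<open>\<epsilon> + a < 1\<close> and a second integration still converges.\<close>
  define \<epsilon> where "\<epsilon> = (1 - a) / 2"
  have \<epsilon>: "0 < \<epsilon>" using pos by (simp add: \<epsilon>_def)
  have \<epsilon>_eq: "- \<epsilon> - a = \<epsilon> - 1" by (simp add: \<epsilon>_def field_simps)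
  define A1 where "A1 = A + A / \<beta>"
  define A2 where "A2 = A1 + A / \<epsilon>"
  define C where "C = B * A1 / \<kappa> + B * A2 / \<epsilon>"
  have C: "C = radial_constant \<beta> a A B"
    unfolding C_def A2_def A1_def \<epsilon>_def \<kappa>(1) radial_constant_def ..
  have nn: "0 \<le> A1" "0 \<le> A2" "0 \<le> C"
    using pos \<kappa> \<epsilon> by (auto simp: A1_def A2_def C_def)
  define \<delta> where "\<delta> = N powr (- 1 / \<beta>)"
  have \<delta>: "0 < \<delta>" "\<delta> \<le> 1"
    using N pos powr_mono[of "- 1 / \<beta>" 0 N] by (auto simp: \<delta>_def)
  have N\<delta>: "N = \<delta> powr (- \<beta>)" "N powr (\<kappa> / \<beta>) = \<delta> powr (- \<kappa>)"
    using N pos by (auto simp: \<delta>_def powr_powr field_simps)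
  define t0 where "t0 = 1 - \<delta>"
  have t0: "0 \<le> t0" "t0 < 1" "1 - t0 = \<delta>"
    using \<delta> by (auto simp: t0_def)
  have u1: "cmod (u t) \<le> A1 * (1 - t) powr (- \<beta>)" if t: "0 \<le> t" "t < 1" for t
  proof -
    have "cmod (u t - u 0) \<le> A / \<beta> * ((1 - t) powr (- \<beta>) - (1 - 0) powr (- \<beta>))"
      using t pos du u'1 by (intro increment_le_powr[where g' = u']) auto
    also have "\<dots> \<le> A / \<beta> * (1 - t) powr (- \<beta>)"
      using pos by (intro mult_left_mono) auto
    finally have "cmod (u t) \<le> A * 1 + A / \<beta> * (1 - t) powr (- \<beta>)"
      using u0 norm_triangle_ineq2[of "u t" "u 0"] by linarith
    also have "\<dots> \<le> A * (1 - t) powr (- \<beta>) + A / \<beta> * (1 - t) powr (- \<beta>)"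
      using t pos powr_mono'[of "- \<beta>" 0 "1 - t"] by (intro add_mono mult_left_mono) auto
    finally show ?thesis
      by (simp add: A1_def algebra_simps)
  qed
  have F1: "cmod (F t) \<le> B * A1 / \<kappa> * \<delta> powr (- \<kappa>)" if t: "0 \<le> t" "t \<le> t0" for t
  proof -
    have t1: "t < 1" using t t0 by simp
    have "cmod (F t - F 0) \<le> B * A1 / \<kappa> * ((1 - t) powr (- \<kappa>) - (1 - 0) powr (- \<kappa>))"
    proof (rule increment_le_powr[where g' = F'])
      fix x assume x: "0 \<le> x" "x \<le> t"
      then have x1: "0 \<le> x" "x < 1" using t1 by auto
      have "cmod (F' x) \<le> B * cmod (u x) * (1 - x) powr (- a)"
        by (rule F'[OF x1])
      also have "\<dots> \<le> B * (A1 * (1 - x) powr (- \<beta>)) * (1 - x) powr (- a)"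
        using u1[OF x1] pos by (intro mult_right_mono mult_left_mono) auto
      also have "\<dots> = B * A1 * (1 - x) powr (- \<kappa> - 1)"
        using x1 \<kappa> by (simp add: mult.assoc flip: powr_add)
      finally show "cmod (F' x) \<le> B * A1 * (1 - x) powr (- \<kappa> - 1)" .
    qed (use t t1 \<kappa> dF in auto)
    also have "\<dots> \<le> B * A1 / \<kappa> * \<delta> powr (- \<kappa>)"
      using pos nn \<kappa> \<delta> t t0 powr_mono2'[of "- \<kappa>" \<delta> "1 - t"]
      by (intro mult_left_mono) auto
    finally show ?thesis using F0 by simp
  qed
  have u2: "cmod (u t) \<le> A2 * \<delta> powr (\<epsilon> - \<beta>) * (1 - t) powr (- \<epsilon>)" if t: "t0 \<le> t" "t < 1" for t
  proof -
    have ge1: "1 \<le> \<delta> powr \<epsilon> * (1 - x) powr (- \<epsilon>)" if "t0 \<le> x" "x < 1" for x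
    proof -
      have "(1 - x) powr \<epsilon> \<le> \<delta> powr \<epsilon>"
        using that t0 \<epsilon> by (intro powr_mono2) auto
      then show ?thesis
        using that by (simp add: powr_minus field_simps)
    qed
    have "cmod (u t - u t0) \<le> A * \<delta> powr (\<epsilon> - \<beta>) / \<epsilon> * ((1 - t) powr (- \<epsilon>) - (1 - t0) powr (- \<epsilon>))"
    proof (rule increment_le_powr[where g' = u'])
      fix x assume x: "t0 \<le> x" "x \<le> t"
      then have x1: "0 \<le> x" "x < 1" using t t0 by auto
      have "cmod (u' x) \<le> (A * N / (1 - x)) * 1"
        using u'2[OF x1] by simp
      also have "\<dots> \<le> (A * N / (1 - x)) * (\<delta> powr \<epsilon> * (1 - x) powr (- \<epsilon>))"
        using ge1[of x] x1 x pos N by (intro mult_left_mono) auto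
      also have "\<dots> = A * \<delta> powr (\<epsilon> - \<beta>) * (1 - x) powr (- \<epsilon> - 1)"
        using x1 \<delta> by (simp add: N\<delta>(1) powr_diff powr_minus field_simps)
      finally show "cmod (u' x) \<le> A * \<delta> powr (\<epsilon> - \<beta>) * (1 - x) powr (- \<epsilon> - 1)" .
    qed (use t t0 \<epsilon> du in auto)
    also have "\<dots> \<le> A * \<delta> powr (\<epsilon> - \<beta>) / \<epsilon> * (1 - t) powr (- \<epsilon>)"
      using pos \<epsilon> by (intro mult_left_mono) auto
    finally have "cmod (u t) \<le> cmod (u t0) + A * \<delta> powr (\<epsilon> - \<beta>) / \<epsilon> * (1 - t) powr (- \<epsilon>)"
      using norm_triangle_ineq2[of "u t" "u t0"] by linarith
    also have "cmod (u t0) \<le> A1 * \<delta> powr (- \<beta>) * 1"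
      using u1[of t0] t0 by simp
    also have "\<dots> \<le> A1 * \<delta> powr (- \<beta>) * (\<delta> powr \<epsilon> * (1 - t) powr (- \<epsilon>))"
      using ge1[of t] t nn by (intro mult_left_mono) auto
    also have "\<dots> = A1 * \<delta> powr (\<epsilon> - \<beta>) * (1 - t) powr (- \<epsilon>)"
      using \<delta> by (simp add: powr_diff powr_minus field_simps)
    finally show ?thesis
      by (simp add: A2_def algebra_simps)
  qed
  have F2: "cmod (F r' - F r) \<le> B * A2 * \<delta> powr (\<epsilon> - \<beta>) / \<epsilon> * (1 - r) powr \<epsilon>"
    if r: "t0 \<le> r" "r \<le> r'" "r' < 1" for r r'
  proof -
    have "cmod (F r' - F r) \<le> B * A2 * \<delta> powr (\<epsilon> - \<beta>) / (- \<epsilon>) * ((1 - r') powr (- (- \<epsilon>)) - (1 - r) powr (- (- \<epsilon>)))"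
    proof (rule increment_le_powr[where g' = F'])
      fix x assume x: "r \<le> x" "x \<le> r'"
      then have x1: "0 \<le> x" "x < 1" "t0 \<le> x" using r t0 by auto
      have "cmod (F' x) \<le> B * cmod (u x) * (1 - x) powr (- a)"
        using F' x1 by simp
      also have "\<dots> \<le> B * (A2 * \<delta> powr (\<epsilon> - \<beta>) * (1 - x) powr (- \<epsilon>)) * (1 - x) powr (- a)"
        using u2[of x] x1 pos by (intro mult_right_mono mult_left_mono) auto
      also have "\<dots> = B * A2 * \<delta> powr (\<epsilon> - \<beta>) * (1 - x) powr (- (- \<epsilon>) - 1)"
        using \<epsilon>_eq by (simp add: mult.assoc flip: powr_add)
      finally show "cmod (F' x) \<le> B * A2 * \<delta> powr (\<epsilon> - \<beta>) * (1 - x) powr (- (- \<epsilon>) - 1)" .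
    qed (use r t0 \<epsilon> dF in auto)
    also have "\<dots> = B * A2 * \<delta> powr (\<epsilon> - \<beta>) / \<epsilon> * ((1 - r) powr \<epsilon> - (1 - r') powr \<epsilon>)"
      unfolding minus_minus by (simp add: right_diff_distrib)
    also have "\<dots> \<le> B * A2 * \<delta> powr (\<epsilon> - \<beta>) / \<epsilon> * (1 - r) powr \<epsilon>"
      using pos nn \<epsilon> by (intro mult_left_mono) auto
    finally show ?thesis .
  qed
  have "cmod (F t) \<le> C * \<delta> powr (- \<kappa>)" if t: "0 \<le> t" "t < 1" for t
  proof (cases "t \<le> t0")
    case True
    have "B * A1 / \<kappa> * \<delta> powr (- \<kappa>) \<le> C * \<delta> powr (- \<kappa>)"
      using pos nn \<epsilon> by (intro mult_right_mono) (auto simp: C_def)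
    then show ?thesis using F1[OF t(1) True] by linarith
  next
    case False
    have exponent: "(\<epsilon> - \<beta>) + \<epsilon> = - \<kappa>"
      using \<epsilon>_eq \<kappa>(1) by linarith
    have "\<delta> powr (\<epsilon> - \<beta>) * (1 - t0) powr \<epsilon> = \<delta> powr (- \<kappa>)"
      unfolding t0(3) powr_add[symmetric] exponent ..
    then have *: "B * A2 * \<delta> powr (\<epsilon> - \<beta>) / \<epsilon> * (1 - t0) powr \<epsilon> = B * A2 / \<epsilon> * \<delta> powr (- \<kappa>)"
      by (simp add: mult.assoc)
    have "cmod (F t) \<le> cmod (F t0) + cmod (F t - F t0)"
      by (metis add.commute diff_add_cancel norm_triangle_ineq)
    also have "\<dots> \<le> B * A1 / \<kappa> * \<delta> powr (- \<kappa>) + B * A2 * \<delta> powr (\<epsilon> - \<beta>) / \<epsilon> * (1 - t0) powr \<epsilon>"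
      using False t t0 by (intro add_mono F1 F2) auto
    also note *
    finally show ?thesis by (simp add: C_def algebra_simps)
  qed
  moreover have "\<exists>l. (F \<longlongrightarrow> l) (at_left 1)"
  proof (rule convergent_at_left_if_modulus[OF t0(2) F2])
    show "((\<lambda>r. B * A2 * \<delta> powr (\<epsilon> - \<beta>) / \<epsilon> * (1 - r) powr \<epsilon>) \<longlongrightarrow> 0) (at_left 1)"
    proof (rule tendsto_mult_right_zero)
      have "((\<lambda>r. (1 - r) powr \<epsilon>) \<longlongrightarrow> (1 - 1) powr \<epsilon>) (at_left (1::real))"
        using \<epsilon> by (intro tendsto_powr2 tendsto_intros) (auto simp: eventually_at_filter)
      then show "((\<lambda>r. (1 - r) powr \<epsilon>) \<longlongrightarrow> 0) (at_left (1::real))"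
        by simp
    qed
  qed
  ultimately show ?thesis
    by (auto simp: N\<delta>(2) C)
qed

section \<open>Growth on the disc and membership in Hardy spaces\<close>

text \<open>The asymptotic bound holds on an annulus; on the remaining compact disc \<open>f\<close> is bounded, and there
  \<open>(1 - |z|)\<^bsup>-a\<^esup> \<ge> 1\<close>.\<close>

lemma growth_on_disc:
  fixes f :: "complex \<Rightarrow> complex"
  assumes a: "0 < a" and f: "continuous_on (ball 0 1) f"
    and O: "(\<lambda>z. cmod (f z)) \<in> O[at_unit_circle](\<lambda>z. 1 / (1 - cmod z) powr a)"
  obtains B where "0 \<le> B" "\<And>z. z \<in> ball 0 1 \<Longrightarrow> cmod (f z) \<le> B * (1 - cmod z) powr (- a)"
proof -
  obtain c where c: "0 < c"
    and ev: "\<forall>\<^sub>F z in at_unit_circle. norm (cmod (f z)) \<le> c * norm (1 / (1 - cmod z) powr a)"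
    using O by (auto elim!: landau_o.bigE)
  obtain b where b: "b < 1" and near: "\<And>z. b < cmod z \<Longrightarrow> cmod z < 1 \<Longrightarrow> cmod (f z) \<le> c * (1 / (1 - cmod z) powr a)"
    using ev by (auto simp: at_unit_circle_def eventually_filtercomap eventually_at_left[of 0 1])
  have "compact (f ` cball 0 b)"
    using b by (intro compact_continuous_image continuous_on_subset[OF f]) auto
  then have "bounded (f ` cball 0 b)"
    by (rule compact_imp_bounded)
  then obtain M where M: "\<And>z. cmod z \<le> b \<Longrightarrow> cmod (f z) \<le> M"
    unfolding bounded_iff by (meson image_eqI mem_cball_0)
  show thesis
  proof
    show "0 \<le> max c M" using c by simp
    fix z :: complex assume z: "z \<in> ball 0 1"
    have ge1: "1 \<le> (1 - cmod z) powr (- a)"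
      using z a powr_mono'[of "- a" 0 "1 - cmod z"] by simp
    show "cmod (f z) \<le> max c M * (1 - cmod z) powr (- a)"
    proof (cases "cmod z \<le> b")
      case True
      have "cmod (f z) \<le> max c M * 1" using M[OF True] by simp
      also have "\<dots> \<le> max c M * (1 - cmod z) powr (- a)"
        using ge1 c by (intro mult_left_mono) auto
      finally show ?thesis .
    next
      case False
      have "cmod (f z) \<le> c * (1 - cmod z) powr (- a)"
        using near[of z] False z by (simp add: powr_minus_divide)
      also have "\<dots> \<le> max c M * (1 - cmod z) powr (- a)"
        by (intro mult_right_mono) auto
      finally show ?thesis .
    qed
  qed
qed

text \<open>Dominated convergence applied to the radial limits. The limit function is written as a
  sequential limit, because this form is measurable on the whole line, whatever happens on the
  exceptional null set.\<close>

lemma hardy_space_if_dominated: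
  fixes F :: "complex \<Rightarrow> complex"
  assumes q: "0 < q" and F: "F holomorphic_on ball 0 1"
    and W: "set_integrable lborel {0..2 * pi} W"
    and dom: "AE \<theta> in lborel. \<theta> \<in> {0..2 * pi} \<longrightarrow>
                (\<forall>t\<in>{0..<1}. cmod (F (of_real t * cis \<theta>)) powr q \<le> W \<theta>)"
    and lim: "AE \<theta> in lborel. \<theta> \<in> {0..2 * pi} \<longrightarrow>
                (\<exists>l. ((\<lambda>t. F (of_real t * cis \<theta>)) \<longlongrightarrow> l) (at_left 1))"
  shows "F \<in> hardy_space q"
proof -
  define \<rho> where "\<rho> = (\<lambda>n. 1 - 1 / real (Suc n))"
  have \<rho>: "0 \<le> \<rho> n" "\<rho> n < 1" for n
    by (auto simp: \<rho>_def field_simps)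
  have "\<rho> \<longlonglongrightarrow> 1"
    unfolding \<rho>_def using tendsto_diff[OF tendsto_const lim_const_over_n[of 1, THEN LIMSEQ_Suc], of "1::real"] by simp
  then have \<rho>lim: "filterlim \<rho> (at_left 1) sequentially"
    using \<rho> less_imp_neq[OF \<rho>(2)] by (auto simp: filterlim_at intro!: always_eventually)
  define w where "w = (\<lambda>\<theta>. lim (\<lambda>n. F (of_real (\<rho> n) * cis \<theta>)))"
  have cont: "continuous_on UNIV (\<lambda>\<theta>. F (of_real t * cis \<theta>))" if "0 \<le> t" "t < 1" for t
    using that by (intro continuous_on_compose2[OF holomorphic_on_imp_continuous_on[OF F]] continuous_intros)
      (auto simp: norm_mult)
  have meas[measurable]: "(\<lambda>\<theta>. F (of_real t * cis \<theta>)) \<in> borel_measurable borel" if "0 \<le> t" "t < 1" for t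
    using cont[OF that] by (rule borel_measurable_continuous_onI)
  have w[measurable]: "w \<in> borel_measurable borel"
    unfolding w_def using \<rho> by (intro borel_measurable_lim_metric meas) auto
  define J where "J = (LINT \<theta>:{0..2 * pi}|lborel. cmod (w \<theta>) powr q)"
  have J: "((\<lambda>r. LINT \<theta>:{0..2 * pi}|lborel. cmod (F (of_real r * cis \<theta>)) powr q) \<longlongrightarrow> J) (at_left 1)"
  proof (rule tendsto_at_left_sequentially[of 0])
    fix S :: "nat \<Rightarrow> real"
    assume S: "\<And>n. S n < 1" "\<And>n. 0 < S n" "S \<longlonglongrightarrow> 1"
    have Slim: "filterlim S (at_left 1) sequentially"
      using S less_imp_neq[OF S(1)] by (auto simp: filterlim_at intro!: always_eventually)
    have [measurable]: "(\<lambda>\<theta>. F (of_real (S n) * cis \<theta>)) \<in> borel_measurable borel" for n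
      using meas[of "S n"] S less_imp_le by blast
    show "(\<lambda>n. LINT \<theta>:{0..2 * pi}|lborel. cmod (F (of_real (S n) * cis \<theta>)) powr q) \<longlonglongrightarrow> J"
      unfolding J_def set_lebesgue_integral_def
    proof (rule integral_dominated_convergence)
      show "integrable lborel (\<lambda>\<theta>. indicat_real {0..2 * pi} \<theta> *\<^sub>R W \<theta>)"
        using W by (simp add: set_integrable_def)
      show "AE \<theta> in lborel. (\<lambda>n. indicat_real {0..2 * pi} \<theta> *\<^sub>R cmod (F (of_real (S n) * cis \<theta>)) powr q)
              \<longlonglongrightarrow> indicat_real {0..2 * pi} \<theta> *\<^sub>R cmod (w \<theta>) powr q"
        using lim
      proof eventually_elim
        case (elim \<theta>)
        show ?case
        proof (cases "\<theta> \<in> {0..2 * pi}")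
          case True
          then obtain l where l: "((\<lambda>t. F (of_real t * cis \<theta>)) \<longlongrightarrow> l) (at_left 1)"
            using elim by auto
          have "w \<theta> = l"
            unfolding w_def by (intro limI filterlim_compose[OF l \<rho>lim])
          moreover have "(\<lambda>n. F (of_real (S n) * cis \<theta>)) \<longlonglongrightarrow> l"
            by (rule filterlim_compose[OF l Slim])
          ultimately show ?thesis
            using q by (intro tendsto_intros tendsto_powr2) auto
        qed simp
      qed
      show "AE \<theta> in lborel. norm (indicat_real {0..2 * pi} \<theta> *\<^sub>R cmod (F (of_real (S n) * cis \<theta>)) powr q)
              \<le> indicat_real {0..2 * pi} \<theta> *\<^sub>R W \<theta>" for n
        using dom
      proof eventually_elim
        case (elim \<theta>)
        then show ?case
          using S(1,2)[of n] by (auto simp: indicator_def)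
      qed
    qed measurable
  qed simp
  have means: "\<forall>\<^sub>F r in at_left 1. (LINT \<theta>:{0..2 * pi}|lborel. cmod (F (of_real r * cis \<theta>)) powr q) =
      integral {0..2 * pi} (\<lambda>\<theta>. cmod (F (of_real r * cis \<theta>)) powr q)"
  proof (rule eventually_at_leftI[of 0])
    fix r :: real assume r: "r \<in> {0<..<1}"
    have "continuous_on {0..2 * pi} (\<lambda>\<theta>. F (of_real r * cis \<theta>))"
      using cont[of r] r continuous_on_subset by auto
    then have "continuous_on {0..2 * pi} (\<lambda>\<theta>. cmod (F (of_real r * cis \<theta>)) powr q)"
      using q by (intro continuous_on_powr' continuous_intros) auto
    then show "(LINT \<theta>:{0..2 * pi}|lborel. cmod (F (of_real r * cis \<theta>)) powr q) =
      integral {0..2 * pi} (\<lambda>\<theta>. cmod (F (of_real r * cis \<theta>)) powr q)"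
      by (intro set_borel_integral_eq_integral borel_integrable_atLeastAtMost')
  qed simp
  have "((\<lambda>r. (1 / (2 * pi) * (LINT \<theta>:{0..2 * pi}|lborel. cmod (F (of_real r * cis \<theta>)) powr q)) powr (1 / q))
          \<longlongrightarrow> (1 / (2 * pi) * J) powr (1 / q)) (at_left 1)"
    using q by (intro tendsto_powr2 tendsto_intros J)
      (auto simp: set_lebesgue_integral_def intro!: always_eventually mult_nonneg_nonneg integral_nonneg)
  then have "(integral_mean q F \<longlongrightarrow> (1 / (2 * pi) * J) powr (1 / q)) (at_left 1)"
    by (rule Lim_transform_eventually)
      (use means in eventually_elim, simp add: integral_mean_def)
  then show ?thesis
    using F by (auto simp: hardy_space_def)
qed

section \<open>Products of Dirichlet-type functions and functions of slow growth\<close>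

theorem proposition4:
  fixes p p\<^sub>1 p\<^sub>2 :: real and f f\<^sub>1 f\<^sub>2 :: "complex \<Rightarrow> complex"
  assumes "0 < p" "0 < p\<^sub>1" "0 < p\<^sub>2"
    and "p < 1" "1 < p\<^sub>2"
    and "1 / p = 1 / p\<^sub>1 + 1 / p\<^sub>2"
    and "f holomorphic_on ball 0 1"
    and "\<And>z. z \<in> ball 0 1 \<Longrightarrow> f z = f\<^sub>1 z * f\<^sub>2 z"
    and "f\<^sub>1 \<in> dirichlet_space p\<^sub>1"
    and "f\<^sub>2 holomorphic_on ball 0 1"
    and "(\<lambda>z. cmod (f\<^sub>2 z)) \<in> O[at_unit_circle](\<lambda>z. 1 / (1 - cmod z) powr (1 / p\<^sub>2))"
  shows "\<exists>F \<in> hardy_space (p / (1 - p)). \<forall>z \<in> ball 0 1. (F has_field_derivative f z) (at z)"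
proof -
  define q where "q = p / (1 - p)"
  define \<kappa> where "\<kappa> = 1 / q"
  have \<kappa>: "\<kappa> = 1 / p\<^sub>1 + 1 / p\<^sub>2 - 1"
    using assms(1,4,6) by (simp add: \<kappa>_def q_def diff_divide_distrib)
  have q: "0 < q" and \<kappa>_pos: "0 < \<kappa>"
    using assms(1,4) by (simp_all add: \<kappa>_def q_def)
  define h where "h = deriv f\<^sub>1"
  have f1: "f\<^sub>1 holomorphic_on ball 0 1"
    using assms(9) by (simp add: dirichlet_space_def)
  have h: "h holomorphic_on ball 0 1"
    unfolding h_def by (intro holomorphic_deriv f1) auto
  have fin: "(\<integral>\<^sup>+z. dirichlet_density p\<^sub>1 h z \<partial>lborel) < \<infinity>"
  proof -
    have [measurable]: "dirichlet_density p\<^sub>1 h \<in> borel_measurable lborel"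
      using borel_measurable_dirichlet_density[OF assms(2) h] by simp
    have "ennreal (1 / pi) * (\<integral>\<^sup>+z. dirichlet_density p\<^sub>1 h z \<partial>lborel)
        = (\<integral>\<^sup>+z. dirichlet_density p\<^sub>1 h z \<partial>area_measure)"
      unfolding area_measure_def by (simp add: nn_integral_density nn_integral_cmult)
    also have "\<dots> < \<infinity>"
      using assms(9) unfolding dirichlet_space_def dirichlet_norm_powr_def dirichlet_density_def[abs_def] h_def
      by (simp add: ennreal_add_eq_top flip: less_top)
    finally show ?thesis
      by (auto simp: ennreal_mult_less_top ennreal_mult_eq_top_iff)
  qed
  obtain A V where A: "0 \<le> A" and V: "\<And>\<theta>. 0 \<le> V \<theta>" "set_integrable lborel {0..2 * pi} V"
    and h1: "\<And>w. w \<in> ball 0 1 \<Longrightarrow> cmod (h w) \<le> A * (1 - cmod w) powr (- (1 / p\<^sub>1) - 1)"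
    and h2: "AE \<theta> in lborel. \<theta> \<in> {0..2 * pi} \<longrightarrow>
       (\<forall>t\<in>{0..<1}. cmod (h (of_real t * cis \<theta>)) \<le> A * (1 + V \<theta>) powr (1 / p\<^sub>1) / (1 - t))"
    using derivative_radial_majorant[OF assms(2) h fin] by blast
  obtain B where B: "0 \<le> B" and f2: "\<And>z. z \<in> ball 0 1 \<Longrightarrow> cmod (f\<^sub>2 z) \<le> B * (1 - cmod z) powr (- (1 / p\<^sub>2))"
    using growth_on_disc[of "1 / p\<^sub>2" f\<^sub>2] assms(3,10,11) holomorphic_on_imp_continuous_on by auto
  obtain g where g: "\<And>z. z \<in> ball 0 1 \<Longrightarrow> (g has_field_derivative f z) (at z within ball 0 1)"
    using holomorphic_convex_primitive'[OF convex_ball open_ball assms(7)] by blast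
  define F where "F = (\<lambda>z. g z - g 0)"
  have dF: "(F has_field_derivative f z) (at z)" if "z \<in> ball 0 1" for z
    unfolding F_def using g[OF that] that
    by (auto simp: at_within_open[of z "ball 0 1"] intro!: derivative_eq_intros)
  have F: "F holomorphic_on ball 0 1"
    unfolding holomorphic_on_open[OF open_ball]
  proof (intro ballI exI)
    fix z :: complex assume "z \<in> ball 0 1"
    then show "(F has_field_derivative f z) (at z)"
      by (rule dF)
  qed
  define A' where "A' = max A (cmod (f\<^sub>1 0))"
  have A': "0 \<le> A'" "A \<le> A'" "cmod (f\<^sub>1 0) \<le> A'"
    using A by (auto simp: A'_def)
  have exponents: "0 < 1 / p\<^sub>1" "1 / p\<^sub>2 < 1"
    using assms(2,3,5) by simp_all
  define C where "C = radial_constant (1 / p\<^sub>1) (1 / p\<^sub>2) A' B"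
  have C: "0 \<le> C"
    unfolding C_def using exponents A'(1) B \<kappa> \<kappa>_pos by (intro radial_constant_nonneg) auto
  have ray: "((\<lambda>t. k (of_real t * cis \<theta>)) has_vector_derivative cis \<theta> * k' (of_real t * cis \<theta>)) (at t)"
    if k: "\<And>z. z \<in> ball 0 1 \<Longrightarrow> (k has_field_derivative k' z) (at z)" and t: "0 \<le> t" "t < 1"
    for k k' :: "complex \<Rightarrow> complex" and t \<theta> :: real
  proof -
    have "((\<lambda>t. of_real t * cis \<theta>) has_vector_derivative cis \<theta>) (at t)"
      by (auto intro!: derivative_eq_intros)
    moreover have "(k has_field_derivative k' (of_real t * cis \<theta>)) (at (of_real t * cis \<theta>))"
      using t by (intro k) (simp add: norm_mult)
    ultimately show ?thesis
      using field_vector_diff_chain_at[of "\<lambda>t. of_real t * cis \<theta>" "cis \<theta>" t k] by (simp add: o_def)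
  qed
  have bound: "(\<forall>t\<in>{0..<1}. cmod (F (of_real t * cis \<theta>)) \<le> C * ((1 + V \<theta>) powr (1 / p\<^sub>1)) powr (\<kappa> / (1 / p\<^sub>1)))
      \<and> (\<exists>l. ((\<lambda>t. F (of_real t * cis \<theta>)) \<longlongrightarrow> l) (at_left 1))"
    if h2\<theta>: "\<forall>t\<in>{0..<1}. cmod (h (of_real t * cis \<theta>)) \<le> A * (1 + V \<theta>) powr (1 / p\<^sub>1) / (1 - t)" for \<theta>
    unfolding C_def
  proof (rule radial_primitive_bound[OF exponents A'(1) B \<kappa> \<kappa>_pos])
    show "1 \<le> (1 + V \<theta>) powr (1 / p\<^sub>1)"
      using V(1)[of \<theta>] assms(2) by (intro ge_one_powr_ge_zero) auto
    show "((\<lambda>t. f\<^sub>1 (of_real t * cis \<theta>)) has_vector_derivative cis \<theta> * h (of_real t * cis \<theta>)) (at t)"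
      if "0 \<le> t" "t < 1" for t
      using that by (intro ray) (auto simp: h_def intro: holomorphic_derivI[OF f1])
    show "((\<lambda>t. F (of_real t * cis \<theta>)) has_vector_derivative cis \<theta> * f (of_real t * cis \<theta>)) (at t)"
      if "0 \<le> t" "t < 1" for t
      using that by (intro ray dF) auto
    show "cmod (f\<^sub>1 (of_real 0 * cis \<theta>)) \<le> A'" "F (of_real 0 * cis \<theta>) = 0"
      using A' by (simp_all add: F_def)
    fix t :: real assume t: "0 \<le> t" "t < 1"
    then have z: "of_real t * cis \<theta> \<in> ball 0 1" "cmod (of_real t * cis \<theta>) = t"
      by (simp_all add: norm_mult)
    have "cmod (h (of_real t * cis \<theta>)) \<le> A * (1 - t) powr (- (1 / p\<^sub>1) - 1)"
      using h1[OF z(1)] z(2) by simp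
    also have "\<dots> \<le> A' * (1 - t) powr (- (1 / p\<^sub>1) - 1)"
      using A' by (intro mult_right_mono) auto
    finally show "cmod (cis \<theta> * h (of_real t * cis \<theta>)) \<le> A' * (1 - t) powr (- (1 / p\<^sub>1) - 1)"
      by (simp add: norm_mult)
    have "cmod (h (of_real t * cis \<theta>)) \<le> A * (1 + V \<theta>) powr (1 / p\<^sub>1) / (1 - t)"
      using h2\<theta> t by simp
    also have "\<dots> \<le> A' * (1 + V \<theta>) powr (1 / p\<^sub>1) / (1 - t)"
      using A' t by (intro divide_right_mono mult_right_mono) auto
    finally show "cmod (cis \<theta> * h (of_real t * cis \<theta>)) \<le> A' * (1 + V \<theta>) powr (1 / p\<^sub>1) / (1 - t)"
      by (simp add: norm_mult)
    show "cmod (cis \<theta> * f (of_real t * cis \<theta>)) \<le> B * cmod (f\<^sub>1 (of_real t * cis \<theta>)) * (1 - t) powr (- (1 / p\<^sub>2))"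
      using mult_left_mono[OF f2[OF z(1)], of "cmod (f\<^sub>1 (of_real t * cis \<theta>))"] z
      by (simp add: assms(8) norm_mult mult_ac)
  qed
  have power: "cmod x powr q \<le> C powr q * (1 + V \<theta>)"
    if "cmod x \<le> C * ((1 + V \<theta>) powr (1 / p\<^sub>1)) powr (\<kappa> / (1 / p\<^sub>1))" for x \<theta>
  proof -
    have "((1 + V \<theta>) powr (1 / p\<^sub>1)) powr (\<kappa> / (1 / p\<^sub>1)) = (1 + V \<theta>) powr (1 / q)"
      using assms(2) by (simp add: powr_powr \<kappa>_def)
    then have "cmod x powr q \<le> (C * (1 + V \<theta>) powr (1 / q)) powr q"
      using that q by (intro powr_mono2) auto
    also have "\<dots> = C powr q * (1 + V \<theta>)"
      using q C V(1)[of \<theta>] by (simp add: powr_mult powr_powr)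
    finally show ?thesis .
  qed
  have "F \<in> hardy_space q"
  proof (rule hardy_space_if_dominated[OF q F])
    show "set_integrable lborel {0..2 * pi} (\<lambda>\<theta>. C powr q * (1 + V \<theta>))"
      by (intro set_integrable_mult_right set_integral_add V borel_integrable_atLeastAtMost') auto
    show "AE \<theta> in lborel. \<theta> \<in> {0..2 * pi} \<longrightarrow>
        (\<forall>t\<in>{0..<1}. cmod (F (of_real t * cis \<theta>)) powr q \<le> C powr q * (1 + V \<theta>))"
      using h2 by eventually_elim (use bound power in blast)
    show "AE \<theta> in lborel. \<theta> \<in> {0..2 * pi} \<longrightarrow>
        (\<exists>l. ((\<lambda>t. F (of_real t * cis \<theta>)) \<longlongrightarrow> l) (at_left 1))"
      using h2 by eventually_elim (use bound in blast)
  qed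
  then show ?thesis
    using dF unfolding q_def by blast
qed

end
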